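(* Let $r \ge 2$, $d \ge 1$ be integers and $n = (r-1)(d+1)$. Let $v_1,\ldots,v_r \in \mathbb{R}^{r-1}$ be vectors such that $\sum_{i=1}^r v_i = 0$ is, up to scalar multiples, their unique linear dependence. For $x \in \mathbb{R}^d$ let $\overline{x} = (x,1)\in\mathbb{R}^{d+1}$, and identify $\mathbb{R}^{(r-1)\times(d+1)}$ (real $(r-1)\times(d+1)$ matrices) with $\mathbb{R}^n$. For $i=1,\ldots,r$ define $g_i:\mathbb{R}^d\to\mathbb{R}^n$ by $g_i(x) = v_i \overline{x}^T$, let $U_i = \{g_i(x) : x\in\mathbb{R}^d\}$, and define $f_i:\mathbb{R}^n\to\mathbb{R}^d$ by $f_i(y) = \Pi\left(y^T \frac{v_i}{\|v_i\|^2}\right)$, where $\Pi:\mathbb{R}^{d+1}\to\mathbb{R}^d$ is the orthogonal projection deleting the last coordinate. Let $H \subset \mathbb{R}^n$ be an open half-space whose boundary hyperplane contains the origin. Then for each $i=1,\ldots,r$ the set $f_i(H\cap U_i)$ is an open half-space in $\mathbb{R}^d$, and \[ \bigcap_{i=1}^r f_i(H\cap U_i) = \emptyset. \] Furthermore, $\bigcup_{i=1}^r f_i(\overline{H}\cap U_i) = \mathbb{R}^d$, where $\overline{H}$ is the closure of $H$.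
   Formalization: The claim that each f_i(H∩U_i) is an open half-space fails when H contains or misses U_i (e.g. the normal of H is supported on the last column); there the set is stated to be all of R^d or empty, and in every other case a proper open half-space. *)

theory Defs
  imports "HOL-Analysis.Analysis"
begin

text \<open>
  Conventions: \<open>\<real>\<^sup>d\<close> is \<open>real ^ 'd\<close> with \<open>CARD('d) = d\<close>, and \<open>\<real>\<^sup>d\<^sup>+\<^sup>1\<close> is
  \<open>real ^ 'd option\<close>, the index \<open>None\<close> being the last coordinate. Real
  \<open>(r - 1) \<times> (d + 1)\<close> matrices are \<open>real ^ 'd option ^ 'k\<close> with \<open>CARD('k) = r - 1\<close>;
  this type is itself a Euclidean space (with the entrywise inner product) of
  dimension \<open>(r - 1) * (d + 1)\<close>, which is the identification with \<open>\<real>\<^sup>n\<close>.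
\<close>

lemma DIM_matrix_space:
  "DIM(real ^ 'd::finite option ^ 'k::finite) = CARD('k) * (CARD('d) + 1)"
  by simp

definition overline_vec :: "real ^ 'd::finite \<Rightarrow> real ^ 'd option" where
  "overline_vec x = (\<chi> j. case j of None \<Rightarrow> 1 | Some k \<Rightarrow> x $ k)"

definition proj_vec :: "real ^ 'd::finite option \<Rightarrow> real ^ 'd" where
  "proj_vec w = (\<chi> k. w $ Some k)"

text \<open>
  The maps \<open>g\<^sub>i\<close> and \<open>f\<^sub>i\<close> and the set \<open>U\<^sub>i\<close> depend on \<open>i\<close> only through the vector
  \<open>v\<^sub>i\<close>, which is the first argument below.
\<close>

definition g_map :: "real ^ 'k::finite \<Rightarrow> real ^ 'd::finite \<Rightarrow> real ^ 'd option ^ 'k" where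
  "g_map u x = (columnvector u :: real ^ 1 ^ 'k) ** (rowvector (overline_vec x) :: real ^ 'd option ^ 1)"

definition U_set :: "real ^ 'k::finite \<Rightarrow> (real ^ 'd::finite option ^ 'k) set" where
  "U_set u = range (g_map u)"

definition f_map :: "real ^ 'k::finite \<Rightarrow> real ^ 'd::finite option ^ 'k \<Rightarrow> real ^ 'd" where
  "f_map u y = proj_vec (transpose y *v ((1 / (norm u)\<^sup>2) *\<^sub>R u))"

text \<open>
  An open half-space is proper here, as the normal vector \<open>a\<close> is nonzero. A pitfall: a
  linear functional on the matrix space can be constant on the affine subspace \<open>U\<^sub>i\<close> (for
  instance when it only involves the last column of the matrix). Then an open half-space
  \<open>H\<close> either misses \<open>U\<^sub>i\<close> or contains it, and \<open>f\<^sub>i(H \<inter> U\<^sub>i)\<close> is a half-space only in the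
  degenerate sense: it is empty or the whole space.
\<close>

definition open_halfspace :: "'a::euclidean_space set \<Rightarrow> bool" where
  "open_halfspace S \<longleftrightarrow> (\<exists>a b. a \<noteq> 0 \<and> S = {x. a \<bullet> x > b})"

end

theory Submission
  imports Defs
begin

text \<open>
  For \<open>H = {y. a \<bullet> y > 0}\<close> put \<open>h\<^sub>i x = a \<bullet> g\<^sub>i x\<close>. Since \<open>f\<^sub>i\<close> is a left inverse of \<open>g\<^sub>i\<close>,
  the set \<open>f\<^sub>i (H \<inter> U\<^sub>i)\<close> is \<open>{x. h\<^sub>i x > 0}\<close> and \<open>h\<^sub>i\<close> is affine. As \<open>g\<^sub>i x\<close> is linear in \<open>v\<^sub>i\<close>,
  \<open>\<Sum>i. v\<^sub>i = 0\<close> gives \<open>\<Sum>i. h\<^sub>i x = 0\<close>, so at every point the values \<open>h\<^sub>i x\<close> are not all positive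
  and not all negative. The uniqueness of the dependence is needed only for \<open>v\<^sub>i \<noteq> 0\<close>.
\<close>

lemma g_map_nth: "g_map u x $ k $ j = u $ k * overline_vec x $ j"
  by (simp add: g_map_def matrix_matrix_mult_def columnvector_def rowvector_def)

lemma sum_g_map: "(\<Sum>i\<in>I. g_map (v i) x) = g_map (\<Sum>i\<in>I. v i) x"
  by (simp add: vec_eq_iff g_map_nth sum_distrib_right)

lemma g_map_zero [simp]: "g_map 0 x = 0"
  by (simp add: vec_eq_iff g_map_nth)

text \<open>Transposing the rank-one matrix \<open>g_map u x\<close> and applying it to
  \<open>u\<close> scaled by \<open>1 / (norm u)\<^sup>2\<close> returns
  \<open>overline_vec x\<close>, since \<open>u \<bullet> u\<close> cancels the scaling;
  \<open>proj_vec\<close> then drops the entry 1.\<close>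

lemma f_map_g_map:
  assumes "u \<noteq> 0"
  shows "f_map u (g_map u x) = x"
proof -
  have "(\<Sum>k\<in>UNIV. u $ k * x $ j * (u $ k / (norm u)\<^sup>2)) = x $ j" for j
  proof -
    have "(\<Sum>k\<in>UNIV. u $ k * x $ j * (u $ k / (norm u)\<^sup>2)) =
        x $ j / (norm u)\<^sup>2 * (\<Sum>k\<in>UNIV. u $ k * u $ k)"
      unfolding sum_distrib_left by (simp add: mult_ac)
    also have "(\<Sum>k\<in>UNIV. u $ k * u $ k) = (norm u)\<^sup>2"
      by (simp add: power2_norm_eq_inner inner_vec_def)
    finally show ?thesis
      using assms by simp
  qed
  then show ?thesis
    by (simp add: f_map_def proj_vec_def matrix_vector_mult_def transpose_def g_map_nth
        overline_vec_def vec_eq_iff)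
qed

text \<open>The left inverse turns an image under \<open>f_map u\<close> into a preimage under
  \<open>g_map u\<close>. As \<open>S\<close> is arbitrary, this serves both \<open>H\<close> and
  its closure.\<close>

lemma image_f_map_Int_U_set:
  assumes "u \<noteq> 0"
  shows "f_map u ` (S \<inter> U_set u) = {x. g_map u x \<in> S}"
proof
  show "f_map u ` (S \<inter> U_set u) \<subseteq> {x. g_map u x \<in> S}"
    by (auto simp: f_map_g_map[OF assms] U_set_def)
  show "{x. g_map u x \<in> S} \<subseteq> f_map u ` (S \<inter> U_set u)"
  proof
    fix x assume "x \<in> {x. g_map u x \<in> S}"
    then show "x \<in> f_map u ` (S \<inter> U_set u)"
      by (intro image_eqI[of _ _ "g_map u x"]) (auto simp: f_map_g_map[OF assms] U_set_def)
  qed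
qed

lemma inner_overline_vec: "w \<bullet> overline_vec x = proj_vec w \<bullet> x + w $ None"
  by (simp add: inner_vec_def overline_vec_def proj_vec_def UNIV_option_conv sum.reindex)

text \<open>Together with \<open>inner_overline_vec\<close> this exhibits
  \<open>a \<bullet> g_map u x\<close> as an affine function of \<open>x\<close>, with explicit
  slope and constant term.\<close>

lemma inner_g_map: "a \<bullet> g_map u x = (transpose a *v u) \<bullet> overline_vec x"
proof -
  have "a \<bullet> g_map u x = (\<Sum>k\<in>UNIV. \<Sum>j\<in>UNIV. a $ k $ j * u $ k * overline_vec x $ j)"
    by (simp add: inner_vec_def g_map_nth mult_ac)
  also have "\<dots> = (\<Sum>j\<in>UNIV. \<Sum>k\<in>UNIV. a $ k $ j * u $ k * overline_vec x $ j)"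
    by (rule sum.swap)
  finally show ?thesis
    by (simp add: inner_vec_def matrix_vector_mult_def transpose_def sum_distrib_right)
qed

text \<open>For \<open>p = 0\<close> the function is the constant \<open>q\<close>, whose sign
  selects one of the two degenerate cases.\<close>

lemma affine_positive_set_cases:
  fixes p :: "'a::euclidean_space"
  shows "open_halfspace {x. p \<bullet> x + q > 0} \<or> {x. p \<bullet> x + q > 0} = {} \<or> {x. p \<bullet> x + q > 0} = UNIV"
proof (cases "p = 0")
  case False
  moreover have "{x. p \<bullet> x + q > 0} = {x. p \<bullet> x > - q}"
    by auto
  ultimately show ?thesis
    unfolding open_halfspace_def by blast
qed auto

text \<open>The frontier of \<open>{x. a \<bullet> x > b}\<close> is the hyperplane
  \<open>a \<bullet> x = b\<close>, and it contains 0 only if \<open>b = 0\<close>.\<close>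

lemma open_halfspace_frontier_zero:
  assumes "open_halfspace H" "0 \<in> frontier H"
  obtains a where "a \<noteq> 0" "H = {x. a \<bullet> x > 0}"
  using assms by (auto simp: open_halfspace_def frontier_halfspace_gt)

text \<open>If \<open>v i = 0\<close>, the indicator of \<open>i\<close> is a dependence, yet its
  coefficients are not constant.\<close>

lemma unique_dependence_nonzero:
  fixes v :: "nat \<Rightarrow> 'a::real_vector"
  assumes "r \<ge> 2"
    and "\<And>c :: nat \<Rightarrow> real. (\<Sum>i = 1..r. c i *\<^sub>R v i) = 0 \<Longrightarrow> \<exists>t. \<forall>i\<in>{1..r}. c i = t"
    and "i \<in> {1..r}"
  shows "v i \<noteq> 0"
proof
  assume "v i = 0"
  then have "(\<Sum>j = 1..r. (if j = i then 1 else 0 :: real) *\<^sub>R v j) = 0"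
    by (intro sum.neutral) auto
  from assms(2)[OF this] obtain t :: real where t: "\<And>j. j \<in> {1..r} \<Longrightarrow> (if j = i then 1 else 0) = t"
    by blast
  \<comment> \<open>A second index, available because \<open>r \<ge> 2\<close>: the indicator is 0
    there and 1 at \<open>i\<close>.\<close>
  have "(if i = 1 then 2 else 1) \<in> {1..r}" "(if i = 1 then 2 else 1) \<noteq> i"
    using assms(1) by auto
  with t[OF assms(3)] t[of "if i = 1 then 2 else 1"] show False
    by simp
qed

theorem theorem3p3:
  fixes r d :: nat
    and v :: "nat \<Rightarrow> real ^ 'k::finite"
    and H :: "(real ^ 'd::finite option ^ 'k) set"
  assumes "r \<ge> 2" and "d \<ge> 1"
    and "CARD('k) = r - 1" and "CARD('d) = d"
    and "(\<Sum>i = 1..r. v i) = 0"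
    and "\<And>c :: nat \<Rightarrow> real. (\<Sum>i = 1..r. c i *\<^sub>R v i) = 0 \<Longrightarrow> \<exists>t. \<forall>i\<in>{1..r}. c i = t"
    and "open_halfspace H" and "0 \<in> frontier H"
  shows "(\<forall>i\<in>{1..r}.
       open_halfspace (f_map (v i) ` (H \<inter> U_set (v i))) \<or>
       (H \<inter> U_set (v i) = {} \<and> f_map (v i) ` (H \<inter> U_set (v i)) = {}) \<or>
       (U_set (v i) \<subseteq> H \<and> f_map (v i) ` (H \<inter> U_set (v i)) = UNIV)) \<and>
    (\<Inter>i\<in>{1..r}. f_map (v i) ` (H \<inter> U_set (v i))) = {} \<and>
    (\<Union>i\<in>{1..r}. f_map (v i) ` (closure H \<inter> U_set (v i))) = UNIV"
proof -
  let ?I = "{1..r}"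
  obtain a where a: "a \<noteq> 0" and H: "H = {y. a \<bullet> y > 0}"
    using assms(7,8) by (rule open_halfspace_frontier_zero)
  have clH: "closure H = {y. a \<bullet> y \<ge> 0}"
    using a by (simp add: H closure_halfspace_gt)
  have nz: "v i \<noteq> 0" if "i \<in> ?I" for i
    using unique_dependence_nonzero[OF assms(1,6) that] .
  have sum0: "(\<Sum>i\<in>?I. a \<bullet> g_map (v i) x) = 0" for x
    using assms(5) by (simp add: sum_g_map flip: inner_sum_right)
  have ne: "?I \<noteq> {}"
    using assms(1) by auto
  have "open_halfspace (f_map (v i) ` (H \<inter> U_set (v i))) \<or>
       (H \<inter> U_set (v i) = {} \<and> f_map (v i) ` (H \<inter> U_set (v i)) = {}) \<or>
       (U_set (v i) \<subseteq> H \<and> f_map (v i) ` (H \<inter> U_set (v i)) = UNIV)" if "i \<in> ?I" for i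
  proof -
    define w where "w = transpose a *v v i"
    have image: "f_map (v i) ` (H \<inter> U_set (v i)) = {x. proj_vec w \<bullet> x + w $ None > 0}"
      using image_f_map_Int_U_set[OF nz[OF that], of H]
      by (simp add: H w_def inner_g_map inner_overline_vec)
    have "U_set (v i) \<subseteq> H" if "f_map (v i) ` (H \<inter> U_set (v i)) = UNIV"
    proof -
      have "g_map (v i) x \<in> H" for x
        using that image_f_map_Int_U_set[OF nz[OF \<open>i \<in> ?I\<close>], of H] by blast
      then show ?thesis
        unfolding U_set_def by blast
    qed
    then show ?thesis
      \<comment> \<open>In the empty case, an empty image already forces
        \<open>H \<inter> U_set (v i) = {}\<close>.\<close>
      using affine_positive_set_cases[of "proj_vec w" "w $ None", folded image] by blast
  qed
  moreover have "\<not> (\<forall>i\<in>?I. a \<bullet> g_map (v i) x > 0)" for x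
    using sum_pos[of ?I "\<lambda>i. a \<bullet> g_map (v i) x"] sum0[of x] ne
    by (metis finite_atLeastAtMost less_irrefl)
  then have "(\<Inter>i\<in>?I. f_map (v i) ` (H \<inter> U_set (v i))) = {}"
    using nz by (auto simp: image_f_map_Int_U_set H)
  moreover have "\<exists>i\<in>?I. a \<bullet> g_map (v i) x \<ge> 0" for x
  proof (rule ccontr)
    assume "\<not> ?thesis"
    then have "(\<Sum>i\<in>?I. - (a \<bullet> g_map (v i) x)) > 0"
      using ne by (intro sum_pos) (auto simp: not_le)
    then show False
      using sum0[of x] by (simp add: sum_negf)
  qed
  then have "(\<Union>i\<in>?I. f_map (v i) ` (closure H \<inter> U_set (v i))) = UNIV"
    using nz by (auto simp: image_f_map_Int_U_set clH)
  ultimately show ?thesis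
    by blast
qed

end
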